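(* Let $\lambda,\mu\in\mathbb{R}$ and let $f:\mathbb{R}\to\mathbb{R}$ be given by $f(x)=\lfloor\lambda x+\mu\rfloor$. For $x\in\mathbb{R}$ let $\omega_f(x)\subseteq\mathbb{R}\cup\{-\infty,\infty\}$ denote the $\omega$-limit set of $x$ under $f$. (i) If $\lambda>1$ and $\left\lceil-\frac{\mu}{\lambda-1}\right\rceil\leqslant\left\lceil-\frac{\mu-1}{\lambda-1}\right\rceil-1$, then for every $x\in\mathbb{R}$, $$\omega_f(x)=\begin{cases}\{\infty\},&\text{if }x\geqslant\frac{1}{\lambda}\left(\left\lceil-\frac{\mu-1}{\lambda-1}\right\rceil-\mu\right);\\ \{-\infty\},&\text{if }x<\frac{1}{\lambda}\left(\left\lceil-\frac{\mu}{\lambda-1}\right\rceil-\mu\right);\\ \{f(x)\},&\text{if }\frac{1}{\lambda}\left(\left\lceil-\frac{\mu}{\lambda-1}\right\rceil-\mu\right)\leqslant x<\frac{1}{\lambda}\left(\left\lceil-\frac{\mu-1}{\lambda-1}\right\rceil-\mu\right).\end{cases}$$ (ii) If $\lambda>1$ and $\left\lceil-\frac{\mu}{\lambda-1}\right\rceil>\left\lceil-\frac{\mu-1}{\lambda-1}\right\rceil-1$, then for every $x\in\mathbb{R}$, $$\omega_f(x)=\begin{cases}\{\infty\},&\text{if }x\geqslant\frac{1}{\lambda}\left(\left\lfloor-\frac{\mu}{\lambda-1}\right\rfloor-\mu+1\right);\\ \{-\infty\},&\text{if }x<\frac{1}{\lambda}\left(\left\lfloor-\frac{\mu}{\lambda-1}\right\rfloor-\mu+1\right).\end{cases}$$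 (iii) Let $\lambda=1$. If $\mu\geqslant1$, then $\omega_f(x)=\{\infty\}$ for every $x\in\mathbb{R}$. If $\mu<0$, then $\omega_f(x)=\{-\infty\}$ for every $x\in\mathbb{R}$. If $\mu\in[0,1)$, then $\omega_f(x)=\{\lfloor x+\mu\rfloor\}$ for every $x\in\mathbb{R}$. (iv) If $0<\lambda<1$, then for every $x\in\mathbb{R}$, $$\omega_f(x)=\begin{cases}\left\{\left\lfloor-\frac{\mu-1}{\lambda-1}\right\rfloor+1\right\},&\text{if }x\leqslant-\frac{\mu-1}{\lambda-1};\\ \left\{\left\lfloor-\frac{\mu}{\lambda-1}\right\rfloor\right\},&\text{if }x>-\frac{\mu}{\lambda-1};\\ \{f(x)\},&\text{if }-\frac{\mu-1}{\lambda-1}<x\leqslant-\frac{\mu}{\lambda-1}.\end{cases}$$ (v) If $\lambda=0$, then $\omega_f(x)=\{\lfloor\mu\rfloor\}$ for every $x\in\mathbb{R}$. (vi) Suppose $-1<\lambda<0$ and $\left\lfloor-\frac{\mu-1}{\lambda-1}\right\rfloor+1\leqslant\left\lfloor-\frac{\mu}{\lambda-1}\right\rfloor$. If $\frac{1}{\lambda}\left(\left\lfloor-\frac{\mu}{\lambda-1}\right\rfloor-\mu+1\right)<x\leqslant\frac{1}{\lambda}\left(\left\lfloor-\frac{\mu}{\lambda-1}\right\rfloor-\mu\right)$, then $\omega_f(x)=\left\{\left\lfloor-\frac{\mu}{\lambda-1}\right\rfloor\right\}$. If $x\leqslant\frac{1}{\lambda}\left(\left\lfloor-\frac{\mu}{\lambda-1}\right\rfloor-\mu+1\right)$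 or $x>\frac{1}{\lambda}\left(\left\lfloor-\frac{\mu}{\lambda-1}\right\rfloor-\mu\right)$, then $\omega_f(x)$ is either a $2$-cycle of $f$ or $\left\{\left\lfloor-\frac{\mu}{\lambda-1}\right\rfloor\right\}$. (vii) If $-1<\lambda<0$ and $\left\lfloor-\frac{\mu-1}{\lambda-1}\right\rfloor+1>\left\lfloor-\frac{\mu}{\lambda-1}\right\rfloor$, then for every $x\in\mathbb{R}$, $\omega_f(x)$ is a $2$-cycle of $f$. (viii) Suppose $\lambda\leqslant-1$ and $\left\lfloor-\frac{\mu-1}{\lambda-1}\right\rfloor+1\leqslant\left\lfloor-\frac{\mu}{\lambda-1}\right\rfloor$. If $\frac{1}{\lambda}\left(\left\lfloor-\frac{\mu}{\lambda-1}\right\rfloor-\mu+1\right)<x\leqslant\frac{1}{\lambda}\left(\left\lfloor-\frac{\mu}{\lambda-1}\right\rfloor-\mu\right)$, then $\omega_f(x)=\left\{\left\lfloor-\frac{\mu}{\lambda-1}\right\rfloor\right\}$. If $x\leqslant\frac{1}{\lambda}\left(\left\lfloor-\frac{\mu}{\lambda-1}\right\rfloor-\mu+1\right)$ or $x>\frac{1}{\lambda}\left(\left\lfloor-\frac{\mu}{\lambda-1}\right\rfloor-\mu\right)$, then $\omega_f(x)$ is either a $2$-cycle of $f$ or $\{-\infty,\infty\}$. (ix) If $\lambda\leqslant-1$ and $\left\lfloor-\frac{\mu-1}{\lambda-1}\right\rfloor+1>\left\lfloor-\frac{\mu}{\lambda-1}\right\rfloor$, then for every $x\in\mathbb{R}$,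 $\omega_f(x)$ is either a $2$-cycle of $f$ or $\{-\infty,\infty\}$.
   Context: $\lfloor\cdot\rfloor$ and $\lceil\cdot\rceil$ denote the floor and ceiling functions; $f^n$ denotes $n$-fold self-composition. For $x\in\mathbb{R}$, the $\omega$-limit set $\omega_f(x)$ is the set of all $\ell\in\mathbb{R}\cup\{-\infty,\infty\}$ for which there exist non-negative integers $n_1<n_2<\cdots$ such that $f^{n_k}(x)\to\ell$ as $k\to\infty$ (limits taken in the extended real line). A $2$-cycle of $f$ is a set of the form $\{y,f(y)\}$ with $y\in\mathbb{R}$, $f(y)\neq y$ and $f^2(y)=y$. *)

theory Defs
  imports "HOL-Library.Extended_Real"
begin

definition omega_limit :: "(real \<Rightarrow> real) \<Rightarrow> real \<Rightarrow> ereal set" where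
  "omega_limit f x =
     {l. \<exists>n :: nat \<Rightarrow> nat. strict_mono n \<and> (\<lambda>k. ereal ((f ^^ n k) x)) \<longlonglongrightarrow> l}"

definition two_cycle :: "(real \<Rightarrow> real) \<Rightarrow> real set \<Rightarrow> bool" where
  "two_cycle f C \<longleftrightarrow> (\<exists>y. C = {y, f y} \<and> f y \<noteq> y \<and> (f ^^ 2) y = y)"

text \<open>An \<open>\<omega>\<close>-limit set lives in the extended reals, a 2-cycle in the reals, so
  the latter is compared via its image in the extended reals.\<close>

definition omega_is_two_cycle :: "(real \<Rightarrow> real) \<Rightarrow> real \<Rightarrow> bool" where
  "omega_is_two_cycle f x \<longleftrightarrow> (\<exists>C. two_cycle f C \<and> omega_limit f x = ereal ` C)"

end

theory Submission
  imports Defs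
begin

text \<open>After one step the orbit consists of integers, so only the restriction \<open>F\<close> of \<open>f\<close> to the
  integers matters. For \<open>\<lambda> \<ge> 0\<close> the map \<open>F\<close> is monotone, hence its orbits are monotone and either
  diverge or stop at the nearest fixed point in the direction of motion; the fixed points are the
  integers \<open>m\<close> with \<open>0 \<le> (\<lambda> - 1) m + \<mu> < 1\<close>. For \<open>\<lambda> < 0\<close> the map \<open>F\<close> is antitone, so \<open>F \<circ> F\<close> is
  monotone, and the subsequences of even and of odd index are either both eventually constant or
  diverge to opposite infinities. Divergence is impossible for \<open>-1 < \<lambda>\<close>, since orbits are then
  bounded; for \<open>\<lambda> \<le> -1\<close> a fixed point of \<open>F\<close> is its own only integer preimage.\<close>

section \<open>Limit sets read off from the odd and even subsequences\<close>

lemma omega_limit_odd_even: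
  assumes odd: "(\<lambda>k. ereal ((f ^^ (2 * k + 1)) x)) \<longlonglongrightarrow> l1"
    and even: "(\<lambda>k. ereal ((f ^^ (2 * k + 2)) x)) \<longlonglongrightarrow> l2"
  shows "omega_limit f x = {l1, l2}"
proof (intro equalityI subsetI)
  fix l assume "l \<in> {l1, l2}"
  moreover have "strict_mono (\<lambda>k. 2 * k + 1 :: nat)" "strict_mono (\<lambda>k. 2 * k + 2 :: nat)"
    by (auto simp: strict_mono_def)
  ultimately show "l \<in> omega_limit f x"
    using odd even unfolding omega_limit_def by blast
next
  fix l assume "l \<in> omega_limit f x"
  then obtain n where n: "strict_mono n" and lim: "(\<lambda>k. ereal ((f ^^ n k) x)) \<longlonglongrightarrow> l"
    unfolding omega_limit_def by blast
  show "l \<in> {l1, l2}"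
  \<comment> \<open>Separate \<open>l\<close> from \<open>l1\<close> and from \<open>l2\<close> by
    disjoint neighbourhoods: the whole orbit ends up in \<open>V1 \<union> V2\<close>, while the
    chosen subsequence ends up in \<open>U1 \<inter> U2\<close>, which is disjoint from it.\<close>
  proof (rule ccontr)
    assume "l \<notin> {l1, l2}"
    then have ne: "l \<noteq> l1" "l \<noteq> l2" by auto
    obtain U1 V1 where 1: "open U1" "open V1" "l \<in> U1" "l1 \<in> V1" "U1 \<inter> V1 = {}"
      using hausdorff[OF ne(1)] by blast
    obtain U2 V2 where 2: "open U2" "open V2" "l \<in> U2" "l2 \<in> V2" "U2 \<inter> V2 = {}"
      using hausdorff[OF ne(2)] by blast
    obtain N1 where N1: "\<And>k. k \<ge> N1 \<Longrightarrow> ereal ((f ^^ (2 * k + 1)) x) \<in> V1"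
      using topological_tendstoD[OF odd 1(2,4)] unfolding eventually_sequentially by blast
    obtain N2 where N2: "\<And>k. k \<ge> N2 \<Longrightarrow> ereal ((f ^^ (2 * k + 2)) x) \<in> V2"
      using topological_tendstoD[OF even 2(2,4)] unfolding eventually_sequentially by blast
    \<comment> \<open>Even indices are counted as \<open>2 * k + 2\<close>, so
      \<open>j = 2 * i\<close> corresponds to \<open>k = i - 1\<close>; the bound on
      \<open>j\<close> makes \<open>i\<close> positive and puts both parities past \<open>N1\<close>
      and \<open>N2\<close>.\<close>
    have tail: "ereal ((f ^^ j) x) \<in> V1 \<union> V2" if j: "j \<ge> 2 * N1 + 2 * N2 + 2" for j
    proof (cases "even j")
      case True
      then obtain i where "j = 2 * i" by blast
      with j have "j = 2 * (i - 1) + 2" "i - 1 \<ge> N2" by auto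
      then show ?thesis using N2[of "i - 1"] by simp
    next
      case False
      then obtain i where "j = 2 * i + 1" by (blast elim: oddE)
      with j show ?thesis using N1[of i] by simp
    qed
    have "\<forall>\<^sub>F k in sequentially. ereal ((f ^^ n k) x) \<in> U1 \<inter> U2"
      using topological_tendstoD[OF lim, of "U1 \<inter> U2"] 1 2 by (simp add: open_Int)
    moreover have "\<forall>\<^sub>F k in sequentially. n k \<ge> 2 * N1 + 2 * N2 + 2"
      using filterlim_subseq[OF n] by (simp add: filterlim_at_top)
    ultimately have "\<forall>\<^sub>F k in sequentially. False"
      by eventually_elim (use tail 1(5) 2(5) in blast)
    then show False by simp
  qed
qed

section \<open>Monotone integer sequences and orbits of monotone integer maps\<close>

lemma filterlim_uminus_int_at_top:
  fixes g :: "'a \<Rightarrow> int"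
  shows "filterlim (\<lambda>n. - g n) at_top A \<longleftrightarrow> filterlim g at_bot A"
  unfolding filterlim_at_top filterlim_at_bot
proof (intro iffI allI)
  fix Z assume "\<forall>Z. \<forall>\<^sub>F n in A. Z \<le> - g n"
  from this[rule_format, of "- Z"] show "\<forall>\<^sub>F n in A. g n \<le> Z" by simp
next
  fix Z assume "\<forall>Z. \<forall>\<^sub>F n in A. g n \<le> Z"
  from this[rule_format, of "- Z"] show "\<forall>\<^sub>F n in A. Z \<le> - g n"
    by eventually_elim simp
qed

text \<open>A bounded increasing integer sequence has finite range; once it attains the maximum of
  the range it cannot move any more.\<close>

lemma incseq_int_cases:
  fixes g :: "nat \<Rightarrow> int"
  assumes "incseq g"
  obtains (const) N where "\<And>n. n \<ge> N \<Longrightarrow> g n = g N"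
  | (top) "filterlim g at_top sequentially"
proof (cases "\<exists>M. \<forall>n. g n \<le> M")
  case True
  then obtain M where M: "\<And>n. g n \<le> M" by blast
  have "range g \<subseteq> {g 0..M}" using M incseqD[OF assms] by auto
  then have fin: "finite (range g)" by (rule finite_subset) simp
  then have "Max (range g) \<in> range g" by (intro Max_in) auto
  then obtain N where N: "g N = Max (range g)" by auto
  have "g n = g N" if "n \<ge> N" for n
    using incseqD[OF assms that] N Max_ge[OF fin, of "g n"] by simp
  then show thesis by (rule const)
next
  case False
  have "filterlim g at_top sequentially"
    unfolding filterlim_at_top eventually_sequentially
  proof
    fix Z
    obtain n where "g n > Z" using False by (meson not_le)
    then have "Z \<le> g k" if "k \<ge> n" for k using incseqD[OF assms that] by simp
    then show "\<exists>N. \<forall>k\<ge>N. Z \<le> g k" by blast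
  qed
  then show thesis by (rule top)
qed

lemma mono_funpow_incseq:
  fixes F :: "int \<Rightarrow> int"
  assumes "mono F" "m \<le> F m"
  shows "incseq (\<lambda>n. (F ^^ n) m)"
proof (rule incseq_SucI)
  show "(F ^^ n) m \<le> (F ^^ Suc n) m" for n
    by (induction n) (use assms in \<open>auto simp: mono_def\<close>)
qed

text \<open>An orbit that becomes constant has two equal consecutive terms, so its final value is a
  fixed point.\<close>

lemma increasing_orbit_cases:
  fixes F :: "int \<Rightarrow> int"
  assumes "mono F" "m \<le> F m"
  obtains (const) q N where "m \<le> q" "F q = q" "\<And>n. n \<ge> N \<Longrightarrow> (F ^^ n) m = q"
  | (top) "filterlim (\<lambda>n. (F ^^ n) m) at_top sequentially"
  using mono_funpow_incseq[OF assms]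
proof (cases rule: incseq_int_cases)
  case (const N)
  note N = const
  show thesis
  proof (rule that(1)[of "(F ^^ N) m" N])
    show "m \<le> (F ^^ N) m" using incseqD[OF mono_funpow_incseq[OF assms], of 0 N] by simp
    show "F ((F ^^ N) m) = (F ^^ N) m" using N[of "Suc N"] by simp
  qed (rule N)
qed (rule that(2))

text \<open>Conjugation by negation reverses the direction of motion and keeps monotonicity, which
  reduces decreasing orbits to increasing ones.\<close>

lemma funpow_conj_uminus:
  fixes F :: "int \<Rightarrow> int"
  shows "((\<lambda>k. - F (- k)) ^^ n) (- m) = - (F ^^ n) m"
  by (induction n) simp_all

lemma decreasing_orbit_cases:
  fixes F :: "int \<Rightarrow> int"
  assumes "mono F" "F m \<le> m"
  obtains (const) q N where "q \<le> m" "F q = q" "\<And>n. n \<ge> N \<Longrightarrow> (F ^^ n) m = q"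
  | (bot) "filterlim (\<lambda>n. (F ^^ n) m) at_bot sequentially"
proof -
  have "mono (\<lambda>k. - F (- k))" "- m \<le> - F (- (- m))"
    using assms by (auto simp: mono_def)
  then show thesis
  proof (cases rule: increasing_orbit_cases)
    case (const q N)
    then show thesis
      by (intro that(1)[of "- q" N]) (simp_all add: funpow_conj_uminus minus_equation_iff)
  next
    case top
    then show thesis
      by (intro that(2)) (simp add: funpow_conj_uminus filterlim_uminus_int_at_top)
  qed
qed

section \<open>Divergence of integer sequences as convergence in the extended reals\<close>

lemma tendsto_ereal_int_PInf:
  assumes "filterlim g at_top sequentially"
  shows "(\<lambda>n. ereal (real_of_int (g n))) \<longlonglongrightarrow> \<infinity>"
  using filterlim_compose[OF filterlim_real_of_int_at_top assms]
  by (simp add: tendsto_PInfty_eq_at_top)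

lemma tendsto_ereal_int_MInf:
  assumes "filterlim g at_bot sequentially"
  shows "(\<lambda>n. ereal (real_of_int (g n))) \<longlonglongrightarrow> - \<infinity>"
proof -
  have "filterlim (\<lambda>n. - g n) at_top sequentially"
    using assms by (simp add: filterlim_uminus_int_at_top)
  then have "(\<lambda>n. - ereal (real_of_int (- g n))) \<longlonglongrightarrow> - \<infinity>"
    by (intro tendsto_uminus_ereal tendsto_ereal_int_PInf)
  then show ?thesis by simp
qed

section \<open>The floor map and its restriction to the integers\<close>

locale floor_map =
  fixes lam \<mu> :: real
begin

definition f :: "real \<Rightarrow> real" where "f x = real_of_int \<lfloor>lam * x + \<mu>\<rfloor>"

definition F :: "int \<Rightarrow> int" where "F m = \<lfloor>lam * real_of_int m + \<mu>\<rfloor>"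

lemma f_of_int: "f (real_of_int m) = real_of_int (F m)"
  by (simp add: f_def F_def)

lemma funpow_Suc_f: "(f ^^ Suc n) x = real_of_int ((F ^^ n) \<lfloor>lam * x + \<mu>\<rfloor>)"
proof (induction n)
  case 0
  show ?case by (simp add: f_def)
next
  case (Suc n)
  then show ?case by (simp add: f_of_int)
qed

lemma omega_limit_tendsto:
  assumes "(\<lambda>n. ereal (real_of_int ((F ^^ n) \<lfloor>lam * x + \<mu>\<rfloor>))) \<longlonglongrightarrow> l"
  shows "omega_limit f x = {l}"
proof -
  have lim: "(\<lambda>n. ereal ((f ^^ Suc n) x)) \<longlonglongrightarrow> l"
    using assms by (simp only: funpow_Suc_f)
  \<comment> \<open>Along \<open>2 * k\<close> and \<open>2 * k + 1\<close> the shifted orbit runs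
    through the iterates of index \<open>2 * k + 1\<close> and \<open>2 * k + 2\<close>, so
    \<open>omega_limit_odd_even\<close> applies with equal limits.\<close>
  have "strict_mono (\<lambda>k. 2 * k :: nat)" "strict_mono (\<lambda>k. 2 * k + 1 :: nat)"
    by (auto simp: strict_mono_def)
  from this[THEN LIMSEQ_subseq_LIMSEQ[OF lim]]
  have "omega_limit f x = {l, l}"
    by (intro omega_limit_odd_even) (simp_all add: o_def)
  then show ?thesis by simp
qed

lemma omega_limit_const:
  assumes "\<And>n. n \<ge> N \<Longrightarrow> (F ^^ n) \<lfloor>lam * x + \<mu>\<rfloor> = q"
  shows "omega_limit f x = {ereal (real_of_int q)}"
proof (rule omega_limit_tendsto, rule tendsto_eventually)
  show "\<forall>\<^sub>F n in sequentially. ereal (real_of_int ((F ^^ n) \<lfloor>lam * x + \<mu>\<rfloor>)) = ereal (real_of_int q)"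
    using assms by (auto simp: eventually_sequentially)
qed

section \<open>Position of an integer relative to its image\<close>

lemma le_F_iff: "m \<le> F m \<longleftrightarrow> real_of_int m \<le> lam * real_of_int m + \<mu>"
  by (simp add: F_def le_floor_iff)

lemma F_le_iff: "F m \<le> m \<longleftrightarrow> lam * real_of_int m + \<mu> < real_of_int m + 1"
  by (simp add: F_def floor_le_iff)

text \<open>The thresholds \<open>- (\<mu> / (lam - 1))\<close> and
  \<open>- ((\<mu> - 1) / (lam - 1))\<close> are the points \<open>t\<close> where
  \<open>lam * t + \<mu>\<close> equals \<open>t\<close> and \<open>t + 1\<close>. Dividing by the
  negative \<open>lam - 1\<close> reverses the inequality; negative slopes are included.\<close>

lemma le_F_iff_contracting:
  assumes "lam < 1"
  shows "m \<le> F m \<longleftrightarrow> m \<le> \<lfloor>- (\<mu> / (lam - 1))\<rfloor>"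
  unfolding le_F_iff le_floor_iff using assms by (simp add: field_simps)

lemma F_le_iff_contracting:
  assumes "lam < 1"
  shows "F m \<le> m \<longleftrightarrow> \<lfloor>- ((\<mu> - 1) / (lam - 1))\<rfloor> < m"
  unfolding F_le_iff floor_less_iff using assms by (simp add: field_simps)

lemma le_F_iff_expanding:
  assumes "lam > 1"
  shows "m \<le> F m \<longleftrightarrow> \<lceil>- (\<mu> / (lam - 1))\<rceil> \<le> m"
  unfolding le_F_iff ceiling_le_iff using assms by (simp add: field_simps)

lemma F_le_iff_expanding:
  assumes "lam > 1"
  shows "F m \<le> m \<longleftrightarrow> m < \<lceil>- ((\<mu> - 1) / (lam - 1))\<rceil>"
  unfolding F_le_iff less_ceiling_iff using assms by (simp add: field_simps)

lemma mono_F: "lam \<ge> 0 \<Longrightarrow> mono F"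
  unfolding mono_def F_def by (auto intro!: floor_mono mult_left_mono)

lemma antimono_F: "lam \<le> 0 \<Longrightarrow> antimono F"
  unfolding antimono_def F_def by (auto intro!: floor_mono mult_left_mono_neg)

section \<open>Nonnegative slope: orbits that diverge or stop at the next fixed point\<close>

context
  fixes x m
  assumes lam_nonneg: "lam \<ge> 0" and m_def: "m = \<lfloor>lam * x + \<mu>\<rfloor>"
begin

lemma omega_limit_PInf:
  assumes "m \<le> F m" "\<And>q. m \<le> q \<Longrightarrow> F q \<noteq> q"
  shows "omega_limit f x = {\<infinity>}"
  using mono_F[OF lam_nonneg] assms(1)
proof (cases rule: increasing_orbit_cases)
  case top
  then show ?thesis
    unfolding m_def by (intro omega_limit_tendsto tendsto_ereal_int_PInf)
qed (use assms(2) in blast)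

lemma omega_limit_MInf:
  assumes "F m \<le> m" "\<And>q. q \<le> m \<Longrightarrow> F q \<noteq> q"
  shows "omega_limit f x = {- \<infinity>}"
  using mono_F[OF lam_nonneg] assms(1)
proof (cases rule: decreasing_orbit_cases)
  case bot
  then show ?thesis
    unfolding m_def by (intro omega_limit_tendsto tendsto_ereal_int_MInf)
qed (use assms(2) in blast)

text \<open>By monotonicity the orbit cannot jump over the fixed point \<open>q\<close>, which
  excludes divergence, and \<open>before\<close> leaves no fixed point on the way where it could
  stop earlier.\<close>

lemma omega_limit_next_fixed_above:
  assumes "m \<le> q" "F q = q" and before: "\<And>r. m \<le> r \<Longrightarrow> r < q \<Longrightarrow> r < F r"
  shows "omega_limit f x = {ereal (real_of_int q)}"
proof -
  have le: "m \<le> F m" using before[of m] assms(1,2) by (cases "m = q") auto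
  have bound: "(F ^^ n) m \<le> q" for n
    by (induction n) (use assms monoD[OF mono_F[OF lam_nonneg]] in \<open>auto, metis\<close>)
  from mono_F[OF lam_nonneg] le show ?thesis
  proof (cases rule: increasing_orbit_cases)
    case (const r N)
    with bound[of N] before[of r] have "r = q" by force
    with const show ?thesis unfolding m_def by (intro omega_limit_const) auto
  next
    case top
    then have "\<forall>\<^sub>F n in sequentially. q + 1 \<le> (F ^^ n) m" by (simp add: filterlim_at_top)
    then have "\<forall>\<^sub>F n in sequentially. False"
      by (rule eventually_mono) (smt (verit) bound)
    then show ?thesis by simp
  qed
qed

lemma omega_limit_next_fixed_below:
  assumes "q \<le> m" "F q = q" and before: "\<And>r. r \<le> m \<Longrightarrow> q < r \<Longrightarrow> F r < r"
  shows "omega_limit f x = {ereal (real_of_int q)}"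
proof -
  have le: "F m \<le> m" using before[of m] assms(1,2) by (cases "m = q") auto
  have bound: "q \<le> (F ^^ n) m" for n
    by (induction n) (use assms monoD[OF mono_F[OF lam_nonneg]] in \<open>auto, metis\<close>)
  from mono_F[OF lam_nonneg] le show ?thesis
  proof (cases rule: decreasing_orbit_cases)
    case (const r N)
    with bound[of N] before[of r] have "r = q" by force
    with const show ?thesis unfolding m_def by (intro omega_limit_const) auto
  next
    case bot
    then have "\<forall>\<^sub>F n in sequentially. (F ^^ n) m \<le> q - 1" unfolding filterlim_at_bot by blast
    then have "\<forall>\<^sub>F n in sequentially. False"
      by (rule eventually_mono) (smt (verit) bound)
    then show ?thesis by simp
  qed
qed

end

text \<open>Serves slopes of every sign: the first iterate is the integer \<open>f x\<close>, and
  the orbit stays there.\<close>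

lemma omega_limit_fixed:
  assumes "F \<lfloor>lam * x + \<mu>\<rfloor> = \<lfloor>lam * x + \<mu>\<rfloor>"
  shows "omega_limit f x = {ereal (f x)}"
proof -
  have "(F ^^ n) \<lfloor>lam * x + \<mu>\<rfloor> = \<lfloor>lam * x + \<mu>\<rfloor>" for n
    by (induction n) (simp_all add: assms)
  then have "omega_limit f x = {ereal (real_of_int \<lfloor>lam * x + \<mu>\<rfloor>)}" by (rule omega_limit_const)
  then show ?thesis by (simp add: f_def)
qed

section \<open>Negative slope: the trichotomy of fixed point, 2-cycle and divergence\<close>

lemma filterlim_F_at_bot:
  assumes "lam < 0" "filterlim g at_top sequentially"
  shows "filterlim (\<lambda>n. F (g n)) at_bot sequentially"
  unfolding filterlim_at_bot
proof
  fix Z :: int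
  \<comment> \<open>Solving \<open>lam * t + \<mu> \<le> Z\<close> for \<open>t\<close> with
    \<open>lam < 0\<close> gives the lower bound \<open>(Z - \<mu>) / lam\<close>.\<close>
  have "\<forall>\<^sub>F n in sequentially. \<lceil>(Z - \<mu>) / lam\<rceil> \<le> g n"
    using assms(2) by (simp add: filterlim_at_top)
  then show "\<forall>\<^sub>F n in sequentially. F (g n) \<le> Z"
  proof eventually_elim
    case (elim n)
    then have "(Z - \<mu>) / lam \<le> real_of_int (g n)" by (simp add: ceiling_le_iff)
    then have "lam * real_of_int (g n) + \<mu> \<le> real_of_int Z"
      using assms(1) by (simp add: field_simps)
    then show ?case unfolding F_def by (simp add: floor_le_iff)
  qed
qed

lemma filterlim_F_at_top:
  assumes "lam < 0" "filterlim g at_bot sequentially"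
  shows "filterlim (\<lambda>n. F (g n)) at_top sequentially"
  unfolding filterlim_at_top
proof
  fix Z :: int
  have "\<forall>\<^sub>F n in sequentially. g n \<le> \<lfloor>(Z - \<mu>) / lam\<rfloor>"
    using assms(2) by (simp add: filterlim_at_bot)
  then show "\<forall>\<^sub>F n in sequentially. Z \<le> F (g n)"
  proof eventually_elim
    case (elim n)
    then have "real_of_int (g n) \<le> (Z - \<mu>) / lam" by (simp add: le_floor_iff)
    then have "real_of_int Z \<le> lam * real_of_int (g n) + \<mu>"
      using assms(1) by (simp add: field_simps)
    then show ?case unfolding F_def by (simp add: le_floor_iff)
  qed
qed

text \<open>The monotone map \<open>F \<circ> F\<close> generates the odd-indexed iterates, and one
  more \<open>F\<close> gives the even-indexed ones. If the former settle at \<open>q\<close>, the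
  limits are \<open>q\<close> and \<open>F q\<close>; if they diverge, \<open>F\<close> sends the
  latter to the opposite infinity. The case \<open>fixed\<close> also records a time at which the
  orbit equals \<open>q\<close>, so that it can be refuted by
  \<open>orbit_avoids_fixed\<close>.\<close>

lemma omega_limit_negative_cases:
  fixes x
  assumes neg: "lam < 0"
  obtains (fixed) q N where "F q = q" "(f ^^ Suc N) x = real_of_int q"
    "omega_limit f x = {ereal (real_of_int q)}"
  | (cycle) "omega_is_two_cycle f x"
  | (diverge) "omega_limit f x = {- \<infinity>, \<infinity>}"
proof -
  define m where "m = \<lfloor>lam * x + \<mu>\<rfloor>"
  define G where "G = F \<circ> F"
  have "mono G"
    unfolding G_def mono_def using antimonoD[OF antimono_F] neg by simp
  have G_pow: "(F ^^ (2 * k)) m = (G ^^ k) m" for k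
    by (induction k) (simp_all add: G_def)
  have odd: "(f ^^ (2 * k + 1)) x = real_of_int ((G ^^ k) m)" for k
    using funpow_Suc_f[of "2 * k" x] G_pow by (simp add: m_def)
  have even: "(f ^^ (2 * k + 2)) x = real_of_int (F ((G ^^ k) m))" for k
    using funpow_Suc_f[of "2 * k + 1" x] G_pow by (simp add: m_def)
  have const_case: thesis if Gq: "G q = q" and ev: "\<And>n. n \<ge> N \<Longrightarrow> (G ^^ n) m = q" for q N
  proof -
    have "(\<lambda>k. ereal ((f ^^ (2 * k + 1)) x)) \<longlonglongrightarrow> ereal (real_of_int q)"
      unfolding odd by (rule tendsto_eventually) (use ev in \<open>auto simp: eventually_sequentially\<close>)
    moreover have "(\<lambda>k. ereal ((f ^^ (2 * k + 2)) x)) \<longlonglongrightarrow> ereal (real_of_int (F q))"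
      unfolding even by (rule tendsto_eventually) (use ev in \<open>auto simp: eventually_sequentially\<close>)
    ultimately have omega: "omega_limit f x = {ereal (real_of_int q), ereal (real_of_int (F q))}"
      by (rule omega_limit_odd_even)
    show thesis
    proof (cases "F q = q")
      case True
      then show thesis
        \<comment> \<open>The odd index \<open>2 * N + 1\<close> is \<open>Suc (2 * N)\<close>,
          which yields the required hitting time.\<close>
        using fixed[of q "2 * N"] omega odd[of N] ev[of N] by simp
    next
      case False
      have "two_cycle f {real_of_int q, f (real_of_int q)}"
        unfolding two_cycle_def
        by (rule exI[of _ "real_of_int q"])
          (use False Gq in \<open>simp add: f_of_int numeral_2_eq_2 G_def\<close>)
      moreover have "omega_limit f x = ereal ` {real_of_int q, f (real_of_int q)}"
        using omega by (simp add: f_of_int)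
      ultimately show thesis
        using cycle unfolding omega_is_two_cycle_def by blast
    qed
  qed
  consider "m \<le> G m" | "G m \<le> m" by linarith
  then show thesis
  proof cases
    case 1
    from \<open>mono G\<close> 1 show thesis
    proof (cases rule: increasing_orbit_cases)
      case (const q N)
      show thesis by (rule const_case[OF const(2,3)])
    next
      case top
      have "omega_limit f x = {\<infinity>, - \<infinity>}"
        by (rule omega_limit_odd_even; unfold odd even)
          (intro tendsto_ereal_int_PInf tendsto_ereal_int_MInf filterlim_F_at_bot top neg)+
      then show thesis by (intro diverge) auto
    qed
  next
    case 2
    from \<open>mono G\<close> 2 show thesis
    proof (cases rule: decreasing_orbit_cases)
      case (const q N)
      show thesis by (rule const_case[OF const(2,3)])
    next
      case bot
      have "omega_limit f x = {- \<infinity>, \<infinity>}"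
        by (rule omega_limit_odd_even; unfold odd even)
          (intro tendsto_ereal_int_PInf tendsto_ereal_int_MInf filterlim_F_at_top bot neg)+
      then show thesis by (rule diverge)
    qed
  qed
qed

section \<open>Excluding divergence for small slopes and fixed limits for steep ones\<close>

lemma bounded_orbit:
  assumes "\<bar>lam\<bar> < 1"
  shows "\<exists>R. \<forall>n. \<bar>(f ^^ n) x\<bar> \<le> R"
proof -
  \<comment> \<open>The second entry solves
    \<open>\<bar>lam\<bar> * R + \<bar>\<mu>\<bar> + 1 = R\<close>, which makes the interval from
    \<open>- R\<close> to \<open>R\<close> invariant under \<open>f\<close>; the first entry puts
    \<open>x\<close> inside it.\<close>
  define R where "R = max \<bar>x\<bar> ((\<bar>\<mu>\<bar> + 1) / (1 - \<bar>lam\<bar>))"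
  have "(\<bar>\<mu>\<bar> + 1) / (1 - \<bar>lam\<bar>) \<le> R" unfolding R_def by simp
  then have R: "\<bar>lam\<bar> * R + \<bar>\<mu>\<bar> + 1 \<le> R"
    using assms by (simp add: field_simps)
  have "\<bar>(f ^^ n) x\<bar> \<le> R" for n
  proof (induction n)
    case 0
    show ?case by (simp add: R_def)
  next
    case (Suc n)
    let ?y = "(f ^^ n) x"
    have "\<bar>f ?y\<bar> \<le> \<bar>lam * ?y\<bar> + \<bar>\<mu>\<bar> + 1"
      unfolding f_def by linarith
    also have "\<bar>lam * ?y\<bar> \<le> \<bar>lam\<bar> * R"
      unfolding abs_mult using Suc by (intro mult_left_mono) auto
    finally show ?case using R by simp
  qed
  then show ?thesis by blast
qed

lemma PInf_notin_omega_limit: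
  assumes "\<bar>lam\<bar> < 1"
  shows "\<infinity> \<notin> omega_limit f x"
proof
  assume "\<infinity> \<in> omega_limit f x"
  then obtain n where "(\<lambda>k. ereal ((f ^^ n k) x)) \<longlonglongrightarrow> \<infinity>"
    unfolding omega_limit_def by blast
  moreover obtain R where R: "\<And>n. \<bar>(f ^^ n) x\<bar> \<le> R"
    using bounded_orbit[OF assms] by blast
  have "(f ^^ n) x \<le> R" for n using R[of n] by linarith
  ultimately have "\<infinity> \<le> ereal R"
    by (intro LIMSEQ_le_const2) auto
  then show False by simp
qed

text \<open>For \<open>lam \<le> - 1\<close> the values \<open>lam * k + \<mu>\<close> at distinct
  integers are at least 1 apart, so their floors differ. Hence a fixed point has no integer preimage
  other than itself and cannot be entered later.\<close>

lemma orbit_avoids_fixed: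
  assumes "lam \<le> - 1" "F p = p" "\<lfloor>lam * x + \<mu>\<rfloor> \<noteq> p"
  shows "(f ^^ Suc n) x \<noteq> real_of_int p"
proof -
  have preimage: "k = p" if "F k = p" for k
  proof (rule ccontr)
    assume "k \<noteq> p"
    then have "1 \<le> \<bar>real_of_int (k - p)\<bar>" by linarith
    moreover have "1 \<le> \<bar>lam\<bar>" using assms(1) by simp
    ultimately have "1 \<le> \<bar>lam\<bar> * \<bar>real_of_int (k - p)\<bar>"
      by (metis mult_mono mult_1 zero_le_one order_trans)
    then have "1 \<le> \<bar>(lam * real_of_int k + \<mu>) - (lam * real_of_int p + \<mu>)\<bar>"
      by (simp add: abs_mult[symmetric] algebra_simps)
    then show False using that assms(2) unfolding F_def by linarith
  qed
  have "(F ^^ n) \<lfloor>lam * x + \<mu>\<rfloor> \<noteq> p"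
    by (induction n) (use assms(3) preimage in auto)
  then show ?thesis unfolding funpow_Suc_f by simp
qed

text \<open>The two thresholds are \<open>1 / (1 - lam)\<close> apart, which is less than 1 for
  \<open>lam < 0\<close>, so at most one integer fits between their floors.\<close>

lemma fixed_point_negative:
  assumes "lam < 0" "F q = q"
  shows "q = \<lfloor>- (\<mu> / (lam - 1))\<rfloor>" "\<lfloor>- ((\<mu> - 1) / (lam - 1))\<rfloor> < \<lfloor>- (\<mu> / (lam - 1))\<rfloor>"
proof -
  have "- (\<mu> / (lam - 1)) - - ((\<mu> - 1) / (lam - 1)) = - 1 / (lam - 1)"
    by (simp add: diff_divide_distrib)
  also have "\<dots> < 1" using assms(1) by (simp add: field_simps)
  finally have "\<lfloor>- (\<mu> / (lam - 1))\<rfloor> \<le> \<lfloor>- ((\<mu> - 1) / (lam - 1))\<rfloor> + 1" by linarith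
  then show "q = \<lfloor>- (\<mu> / (lam - 1))\<rfloor>" "\<lfloor>- ((\<mu> - 1) / (lam - 1))\<rfloor> < \<lfloor>- (\<mu> / (lam - 1))\<rfloor>"
    using le_F_iff_contracting[of q] F_le_iff_contracting[of q] assms by auto
qed


section \<open>Bounds on the starting point as bounds on the first integer iterate\<close>

lemma threshold_iff:
  assumes "lam > 0"
  shows "1 / lam * (real_of_int k - \<mu>) \<le> x \<longleftrightarrow> k \<le> \<lfloor>lam * x + \<mu>\<rfloor>"
  using assms by (simp add: le_floor_iff field_simps)

lemma threshold_iff_negative:
  assumes "lam < 0"
  shows "x \<le> 1 / lam * (real_of_int k - \<mu>) \<longleftrightarrow> k \<le> \<lfloor>lam * x + \<mu>\<rfloor>"
  using assms by (simp add: le_floor_iff field_simps)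

lemma threshold_iff_negative_Suc:
  assumes "lam < 0"
  shows "x \<le> 1 / lam * (real_of_int k - \<mu> + 1) \<longleftrightarrow> k + 1 \<le> \<lfloor>lam * x + \<mu>\<rfloor>"
  using assms by (simp add: le_floor_iff field_simps)

section \<open>Slope greater than 1\<close>

context
  fixes A B :: int
  assumes expanding: "lam > 1"
    and A: "A = \<lceil>- (\<mu> / (lam - 1))\<rceil>" and B: "B = \<lceil>- ((\<mu> - 1) / (lam - 1))\<rceil>"
begin

text \<open>The fixed points are the integers \<open>q\<close> with \<open>A \<le> q\<close> and
  \<open>q < B\<close>. Because of this order, integers from \<open>B\<close> on move strictly up
  and integers below \<open>A\<close> move strictly down.\<close>

lemma expanding_A_le_B: "A \<le> B"
  unfolding A B using expanding by (intro ceiling_mono) (simp add: field_simps)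

lemma omega_limit_expanding_PInf:
  assumes "1 / lam * (real_of_int B - \<mu>) \<le> x"
  shows "omega_limit f x = {\<infinity>}"
proof (rule omega_limit_PInf)
  have ge: "B \<le> \<lfloor>lam * x + \<mu>\<rfloor>" using assms threshold_iff expanding by simp
  then show "\<lfloor>lam * x + \<mu>\<rfloor> \<le> F \<lfloor>lam * x + \<mu>\<rfloor>"
    using expanding_A_le_B by (simp add: le_F_iff_expanding[OF expanding] A[symmetric])
  show "F q \<noteq> q" if "\<lfloor>lam * x + \<mu>\<rfloor> \<le> q" for q
    using that ge F_le_iff_expanding[OF expanding, of q] B by auto
qed (use expanding in auto)

lemma omega_limit_expanding_MInf:
  assumes "x < 1 / lam * (real_of_int A - \<mu>)"
  shows "omega_limit f x = {- \<infinity>}"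
proof (rule omega_limit_MInf)
  have less: "\<lfloor>lam * x + \<mu>\<rfloor> < A" using assms threshold_iff[of A x] expanding by simp
  then show "F \<lfloor>lam * x + \<mu>\<rfloor> \<le> \<lfloor>lam * x + \<mu>\<rfloor>"
    using expanding_A_le_B by (simp add: F_le_iff_expanding[OF expanding] B[symmetric])
  show "F q \<noteq> q" if "q \<le> \<lfloor>lam * x + \<mu>\<rfloor>" for q
    using that less le_F_iff_expanding[OF expanding, of q] A by auto
qed (use expanding in auto)

lemma omega_limit_expanding_fixed:
  assumes "1 / lam * (real_of_int A - \<mu>) \<le> x" "x < 1 / lam * (real_of_int B - \<mu>)"
  shows "omega_limit f x = {ereal (f x)}"
proof (rule omega_limit_fixed, rule antisym)
  show "F \<lfloor>lam * x + \<mu>\<rfloor> \<le> \<lfloor>lam * x + \<mu>\<rfloor>"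
    using assms(2) threshold_iff[of B x] expanding
    by (simp add: F_le_iff_expanding B[symmetric])
  show "\<lfloor>lam * x + \<mu>\<rfloor> \<le> F \<lfloor>lam * x + \<mu>\<rfloor>"
    using assms(1) threshold_iff[of A x] expanding
    by (simp add: le_F_iff_expanding A[symmetric])
qed

text \<open>Reconciles the floor in the theorem's threshold with the ceilings \<open>A\<close> and
  \<open>B\<close> when there is no fixed point.\<close>

lemma expanding_no_fixed_threshold:
  assumes "B - 1 < A"
  shows "\<lfloor>- (\<mu> / (lam - 1))\<rfloor> + 1 = A" "A = B"
proof -
  show "A = B" using assms expanding_A_le_B by simp
  have "- (\<mu> / (lam - 1)) < - ((\<mu> - 1) / (lam - 1))"
    using expanding by (simp add: field_simps)
  \<comment> \<open>If the smaller threshold were the integer \<open>A\<close>, the strictly larger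
    one would have a ceiling above \<open>A\<close>, contradicting \<open>A = B\<close>. For a
    non-integer, floor plus 1 is the ceiling.\<close>
  then have "- (\<mu> / (lam - 1)) \<noteq> real_of_int A"
    using \<open>A = B\<close> B by (metis less_ceiling_iff less_irrefl)
  then show "\<lfloor>- (\<mu> / (lam - 1))\<rfloor> + 1 = A"
    unfolding A by linarith
qed

end

section \<open>Slope 1: translation by an integer\<close>

context
  assumes translation: "lam = 1"
begin

lemma translation_nonneg: "0 \<le> lam"
  using translation by simp

lemma F_translation: "F m = m + \<lfloor>\<mu>\<rfloor>"
  unfolding F_def using translation by simp

lemma omega_limit_translation_PInf:
  assumes "\<mu> \<ge> 1"
  shows "omega_limit f x = {\<infinity>}"
proof -
  have "\<lfloor>\<mu>\<rfloor> \<ge> 1" using assms by (simp add: le_floor_iff)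
  then show ?thesis
    by (intro omega_limit_PInf[OF translation_nonneg refl]) (unfold F_translation, linarith+)
qed

lemma omega_limit_translation_MInf:
  assumes "\<mu> < 0"
  shows "omega_limit f x = {- \<infinity>}"
proof -
  have "\<lfloor>\<mu>\<rfloor> < 0" using assms by simp
  then show ?thesis
    by (intro omega_limit_MInf[OF translation_nonneg refl]) (unfold F_translation, linarith+)
qed

lemma omega_limit_translation_fixed:
  assumes "\<mu> \<in> {0..<1}"
  shows "omega_limit f x = {ereal (real_of_int \<lfloor>x + \<mu>\<rfloor>)}"
proof -
  have "\<lfloor>\<mu>\<rfloor> = 0" using assms by (simp add: floor_eq_iff)
  then have "omega_limit f x = {ereal (f x)}"
    by (intro omega_limit_fixed) (simp add: F_translation)
  also have "f x = real_of_int \<lfloor>x + \<mu>\<rfloor>" unfolding f_def using translation by simp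
  finally show ?thesis .
qed

end

section \<open>Slope strictly between 0 and 1\<close>

context
  fixes a b :: real
  assumes contracting: "0 < lam" "lam < 1"
    and a: "a = - (\<mu> / (lam - 1))" and b: "b = - ((\<mu> - 1) / (lam - 1))"
begin

text \<open>The distance \<open>a - b\<close> is \<open>1 / (1 - lam)\<close>, at least 1 here, so a
  fixed point exists; the smallest is \<open>\<lfloor>b\<rfloor> + 1\<close> and the largest
  \<open>\<lfloor>a\<rfloor>\<close>.\<close>

lemma contracting_gap: "\<lfloor>b\<rfloor> + 1 \<le> \<lfloor>a\<rfloor>"
proof -
  have "a - b = - 1 / (lam - 1)" unfolding a b by (simp add: diff_divide_distrib)
  moreover have "- 1 / (lam - 1) \<ge> 1" using contracting by (simp add: field_simps)
  ultimately show ?thesis by linarith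
qed

text \<open>Carries a comparison of \<open>x\<close> with \<open>a\<close> or \<open>b\<close> over
  to \<open>lam * x + \<mu>\<close>, hence to the first integer iterate.\<close>

lemma contracting_ends: "lam * a + \<mu> = a" "lam * b + \<mu> = b + 1"
  unfolding a b using contracting by (simp_all add: field_simps)

lemma F_fixed_contracting_iff: "F q = q \<longleftrightarrow> \<lfloor>b\<rfloor> < q \<and> q \<le> \<lfloor>a\<rfloor>"
  using le_F_iff_contracting[of q] F_le_iff_contracting[of q] contracting a b by auto

lemma omega_limit_contracting_below:
  assumes "x \<le> b"
  shows "omega_limit f x = {ereal (real_of_int (\<lfloor>b\<rfloor> + 1))}"
proof (rule omega_limit_next_fixed_above)
  have "lam * x + \<mu> \<le> b + 1"
    using mult_left_mono[OF assms, of lam] assms contracting contracting_ends by linarith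
  then have "\<lfloor>lam * x + \<mu>\<rfloor> \<le> \<lfloor>b + 1\<rfloor>" by (rule floor_mono)
  then show "\<lfloor>lam * x + \<mu>\<rfloor> \<le> \<lfloor>b\<rfloor> + 1" by simp
  show "F (\<lfloor>b\<rfloor> + 1) = \<lfloor>b\<rfloor> + 1" using contracting_gap by (simp add: F_fixed_contracting_iff)
  show "r < F r" if "r < \<lfloor>b\<rfloor> + 1" for r
    using that F_le_iff_contracting[of r] contracting b by force
qed (use contracting in auto)

lemma omega_limit_contracting_above:
  assumes "a < x"
  shows "omega_limit f x = {ereal (real_of_int \<lfloor>a\<rfloor>)}"
proof (rule omega_limit_next_fixed_below)
  have "a \<le> lam * x + \<mu>"
    using mult_left_mono[of a x lam] assms contracting contracting_ends by linarith
  then show "\<lfloor>a\<rfloor> \<le> \<lfloor>lam * x + \<mu>\<rfloor>" by (rule floor_mono)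
  show "F \<lfloor>a\<rfloor> = \<lfloor>a\<rfloor>" using contracting_gap by (simp add: F_fixed_contracting_iff)
  show "F r < r" if "\<lfloor>a\<rfloor> < r" for r
    using that le_F_iff_contracting[of r] contracting a by force
qed (use contracting in auto)

lemma omega_limit_contracting_fixed:
  assumes "b < x" "x \<le> a"
  shows "omega_limit f x = {ereal (f x)}"
proof (rule omega_limit_fixed)
  have "b + 1 < lam * x + \<mu>"
    using mult_strict_left_mono[OF assms(1), of lam] assms contracting contracting_ends by linarith
  moreover have "lam * x + \<mu> \<le> a"
    using mult_left_mono[OF assms(2), of lam] assms contracting contracting_ends by linarith
  ultimately show "F \<lfloor>lam * x + \<mu>\<rfloor> = \<lfloor>lam * x + \<mu>\<rfloor>"
    unfolding F_fixed_contracting_iff by linarith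
qed

end

section \<open>Slope 0\<close>

lemma omega_limit_constant:
  assumes "lam = 0"
  shows "omega_limit f x = {ereal (real_of_int \<lfloor>\<mu>\<rfloor>)}"
proof -
  have "omega_limit f x = {ereal (f x)}"
    by (rule omega_limit_fixed) (unfold F_def, simp add: assms)
  also have "f x = real_of_int \<lfloor>\<mu>\<rfloor>" unfolding f_def by (simp add: assms)
  finally show ?thesis .
qed

section \<open>Negative slope: the cases of the theorem\<close>

context
  fixes p c :: int
  assumes negative: "lam < 0"
    and p: "p = \<lfloor>- (\<mu> / (lam - 1))\<rfloor>" and c: "c = \<lfloor>- ((\<mu> - 1) / (lam - 1))\<rfloor>"
begin

lemma F_fixed_negative: "c + 1 \<le> p \<Longrightarrow> F p = p"
  using le_F_iff_contracting[of p] F_le_iff_contracting[of p] negative p c by auto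

lemma omega_limit_negative_fixed:
  assumes "c + 1 \<le> p"
    and "1 / lam * (real_of_int p - \<mu> + 1) < x" "x \<le> 1 / lam * (real_of_int p - \<mu>)"
  shows "omega_limit f x = {ereal (real_of_int p)}"
proof -
  have "\<lfloor>lam * x + \<mu>\<rfloor> = p"
    using threshold_iff_negative[OF negative, of x p] assms(2,3)
      threshold_iff_negative_Suc[OF negative, of x p] by linarith
  moreover from this have "omega_limit f x = {ereal (f x)}"
    using F_fixed_negative[OF assms(1)] by (intro omega_limit_fixed) simp
  ultimately show ?thesis by (simp add: f_def)
qed

text \<open>Bounded orbits exclude divergence. Keeping \<open>c + 1 \<le> p\<close> in the second
  alternative lets one statement serve both cases: when that inequality fails, only the 2-cycle is
  left.\<close>

lemma omega_limit_negative_contracting_cases: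
  assumes "- 1 < lam"
  shows "omega_is_two_cycle f x \<or> c + 1 \<le> p \<and> omega_limit f x = {ereal (real_of_int p)}"
  using negative
proof (cases rule: omega_limit_negative_cases[where x = x])
  case (fixed q N)
  with fixed_point_negative[OF negative fixed(1)] show ?thesis by (auto simp: p c)
next
  case diverge
  then show ?thesis using PInf_notin_omega_limit[of x] assms negative by simp
qed simp

text \<open>The second hypothesis says that there is no fixed point or that the first iterate misses
  it. Either way the orbit never meets a fixed point, which refutes the case
  \<open>fixed\<close>.\<close>

lemma omega_limit_negative_expanding_cases:
  assumes "lam \<le> - 1"
    and "p < c + 1 \<or> x \<le> 1 / lam * (real_of_int p - \<mu> + 1) \<or> 1 / lam * (real_of_int p - \<mu>) < x"
  shows "omega_is_two_cycle f x \<or> omega_limit f x = {- \<infinity>, \<infinity>}"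
  using negative
proof (cases rule: omega_limit_negative_cases[where x = x])
  case (fixed q N)
  note q = fixed_point_negative[OF negative fixed(1)]
  have "\<lfloor>lam * x + \<mu>\<rfloor> \<noteq> q"
    using threshold_iff_negative[OF negative, of x p] assms(2) q p c
      threshold_iff_negative_Suc[OF negative, of x p] by linarith
  then show ?thesis
    using orbit_avoids_fixed[OF assms(1) fixed(1)] fixed(2) by blast
qed auto

end

end

section \<open>Assembly of the cases\<close>

theorem theorem3:
  fixes lam \<mu> :: real and f :: "real \<Rightarrow> real"
  assumes f_def: "f = (\<lambda>x. real_of_int \<lfloor>lam * x + \<mu>\<rfloor>)"
  shows
    "(lam > 1 \<and> \<lceil>- (\<mu> / (lam - 1))\<rceil> \<le> \<lceil>- ((\<mu> - 1) / (lam - 1))\<rceil> - 1 \<longrightarrow>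
        (\<forall>x.
          (x \<ge> 1 / lam * (real_of_int \<lceil>- ((\<mu> - 1) / (lam - 1))\<rceil> - \<mu>) \<longrightarrow>
             omega_limit f x = {\<infinity>}) \<and>
          (x < 1 / lam * (real_of_int \<lceil>- (\<mu> / (lam - 1))\<rceil> - \<mu>) \<longrightarrow>
             omega_limit f x = {- \<infinity>}) \<and>
          (1 / lam * (real_of_int \<lceil>- (\<mu> / (lam - 1))\<rceil> - \<mu>) \<le> x \<and> x < 1 / lam * (real_of_int \<lceil>- ((\<mu> - 1) / (lam - 1))\<rceil> - \<mu>) \<longrightarrow>
             omega_limit f x = {ereal (f x)}))) \<and>
     (lam > 1 \<and> \<lceil>- (\<mu> / (lam - 1))\<rceil> > \<lceil>- ((\<mu> - 1) / (lam - 1))\<rceil> - 1 \<longrightarrow>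
        (\<forall>x.
          (x \<ge> 1 / lam * (real_of_int \<lfloor>- (\<mu> / (lam - 1))\<rfloor> - \<mu> + 1) \<longrightarrow>
             omega_limit f x = {\<infinity>}) \<and>
          (x < 1 / lam * (real_of_int \<lfloor>- (\<mu> / (lam - 1))\<rfloor> - \<mu> + 1) \<longrightarrow>
             omega_limit f x = {- \<infinity>}))) \<and>
     (lam = 1 \<longrightarrow>
        (\<mu> \<ge> 1 \<longrightarrow> (\<forall>x. omega_limit f x = {\<infinity>})) \<and>
        (\<mu> < 0 \<longrightarrow> (\<forall>x. omega_limit f x = {- \<infinity>})) \<and>
        (\<mu> \<in> {0..<1} \<longrightarrow> (\<forall>x. omega_limit f x = {ereal (real_of_int \<lfloor>x + \<mu>\<rfloor>)}))) \<and>
     (0 < lam \<and> lam < 1 \<longrightarrow>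
        (\<forall>x.
          (x \<le> - ((\<mu> - 1) / (lam - 1)) \<longrightarrow>
             omega_limit f x = {ereal (real_of_int \<lfloor>- ((\<mu> - 1) / (lam - 1))\<rfloor> + 1)}) \<and>
          (x > - (\<mu> / (lam - 1)) \<longrightarrow>
             omega_limit f x = {ereal (real_of_int \<lfloor>- (\<mu> / (lam - 1))\<rfloor>)}) \<and>
          (- ((\<mu> - 1) / (lam - 1)) < x \<and> x \<le> - (\<mu> / (lam - 1)) \<longrightarrow>
             omega_limit f x = {ereal (f x)}))) \<and>
     (lam = 0 \<longrightarrow>
        (\<forall>x. omega_limit f x = {ereal (real_of_int \<lfloor>\<mu>\<rfloor>)})) \<and>
     (- 1 < lam \<and> lam < 0 \<and> \<lfloor>- ((\<mu> - 1) / (lam - 1))\<rfloor> + 1 \<le> \<lfloor>- (\<mu> / (lam - 1))\<rfloor> \<longrightarrow>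
        (\<forall>x.
          (1 / lam * (real_of_int \<lfloor>- (\<mu> / (lam - 1))\<rfloor> - \<mu> + 1) < x \<and> x \<le> 1 / lam * (real_of_int \<lfloor>- (\<mu> / (lam - 1))\<rfloor> - \<mu>) \<longrightarrow>
             omega_limit f x = {ereal (real_of_int \<lfloor>- (\<mu> / (lam - 1))\<rfloor>)}) \<and>
          (x \<le> 1 / lam * (real_of_int \<lfloor>- (\<mu> / (lam - 1))\<rfloor> - \<mu> + 1) \<or> x > 1 / lam * (real_of_int \<lfloor>- (\<mu> / (lam - 1))\<rfloor> - \<mu>) \<longrightarrow>
             omega_is_two_cycle f x \<or> omega_limit f x = {ereal (real_of_int \<lfloor>- (\<mu> / (lam - 1))\<rfloor>)}))) \<and>
     (- 1 < lam \<and> lam < 0 \<and> \<lfloor>- ((\<mu> - 1) / (lam - 1))\<rfloor> + 1 > \<lfloor>- (\<mu> / (lam - 1))\<rfloor> \<longrightarrow>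
        (\<forall>x. omega_is_two_cycle f x)) \<and>
     (lam \<le> - 1 \<and> \<lfloor>- ((\<mu> - 1) / (lam - 1))\<rfloor> + 1 \<le> \<lfloor>- (\<mu> / (lam - 1))\<rfloor> \<longrightarrow>
        (\<forall>x.
          (1 / lam * (real_of_int \<lfloor>- (\<mu> / (lam - 1))\<rfloor> - \<mu> + 1) < x \<and> x \<le> 1 / lam * (real_of_int \<lfloor>- (\<mu> / (lam - 1))\<rfloor> - \<mu>) \<longrightarrow>
             omega_limit f x = {ereal (real_of_int \<lfloor>- (\<mu> / (lam - 1))\<rfloor>)}) \<and>
          (x \<le> 1 / lam * (real_of_int \<lfloor>- (\<mu> / (lam - 1))\<rfloor> - \<mu> + 1) \<or> x > 1 / lam * (real_of_int \<lfloor>- (\<mu> / (lam - 1))\<rfloor> - \<mu>) \<longrightarrow>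
             omega_is_two_cycle f x \<or> omega_limit f x = {- \<infinity>, \<infinity>}))) \<and>
     (lam \<le> - 1 \<and> \<lfloor>- ((\<mu> - 1) / (lam - 1))\<rfloor> + 1 > \<lfloor>- (\<mu> / (lam - 1))\<rfloor> \<longrightarrow>
        (\<forall>x. omega_is_two_cycle f x \<or> omega_limit f x = {- \<infinity>, \<infinity>}))"
proof -
  have f: "f = floor_map.f lam \<mu>"
    by (rule ext) (simp add: f_def floor_map.f_def)
  interpret floor_map lam \<mu> .
  note expanding = omega_limit_expanding_PInf[OF _ refl refl] omega_limit_expanding_MInf[OF _ refl refl]
    omega_limit_expanding_fixed[OF _ refl refl] expanding_no_fixed_threshold[OF _ refl refl]
  show ?thesis
    unfolding f
  proof ((intro conjI impI allI; (elim conjE)?), goal_cases)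
    \<comment> \<open>Goals 4 and 5 concern \<open>lam > 1\<close> without fixed points: the single
      floor threshold is rewritten to the ceiling \<open>B\<close> for divergence to
      \<open>\<infinity>\<close> and to the ceiling \<open>A\<close> for divergence to
      \<open>- \<infinity>\<close>.\<close>
    case (4 x)
    then have "real_of_int \<lfloor>- (\<mu> / (lam - 1))\<rfloor> - \<mu> + 1 = real_of_int \<lceil>- ((\<mu> - 1) / (lam - 1))\<rceil> - \<mu>"
      using expanding(4,5) by force
    with 4 show ?case using expanding(1) by simp
  next
    case (5 x)
    then have "real_of_int \<lfloor>- (\<mu> / (lam - 1))\<rfloor> - \<mu> + 1 = real_of_int \<lceil>- (\<mu> / (lam - 1))\<rceil> - \<mu>"
      using expanding(4) by force
    with 5 show ?case using expanding(2) by simp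
  next
    case (9 x)
    then show ?case
      using omega_limit_contracting_below[OF _ _ refl refl] by simp
  next
    case (17 x)
    then show ?case
      using omega_limit_negative_expanding_cases[OF _ refl refl] by simp
  qed (use expanding omega_limit_translation_PInf omega_limit_translation_MInf
      omega_limit_translation_fixed omega_limit_contracting_above[OF _ _ refl refl]
      omega_limit_contracting_fixed[OF _ _ refl refl] omega_limit_constant
      omega_limit_negative_fixed[OF _ refl refl]
      omega_limit_negative_contracting_cases[OF _ refl refl]
      omega_limit_negative_expanding_cases[OF _ refl refl] in force)+
qed

end
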